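(* Let $n\ge 1$ be an integer, let $k\in\mathbb{Z}$, and let $G$ be an Abelian group of homology coefficients. The function $d_T$ is an extended pseudo-distance on the multidimensional $k$th persistent homology groups $H_k^{(X,\vec\varphi)}$ of pairs $(X,\vec\varphi)$, where $X$ is a topological space and $\vec\varphi:X\to\mathbb{R}^n$ is a continuous function.
   Context: For $\vec u=(u_1,\dots,u_n),\vec v=(v_1,\dots,v_n)\in\mathbb{R}^n$ write $\vec u\preceq\vec v$ (resp. $\vec u\prec\vec v$) if $u_i\le v_i$ (resp. $u_i<v_i$) for all $i$. Let $\Delta^+=\{(\vec u,\vec v)\in\mathbb{R}^n\times\mathbb{R}^n:\vec u\prec\vec v\}$. For a function $\vec\varphi:X\to\mathbb{R}^n$ put $X\langle\vec\varphi\preceq\vec u\rangle=\{x\in X:\varphi_i(x)\le u_i,\ i=1,\dots,n\}$. Persistent homology group: let $X$ be a topological space and $\vec\varphi:X\to\mathbb{R}^n$ continuous. $H_k$ denotes $k$th (singular) homology with coefficients in $G$. For $(\vec u,\vec v)\in\Delta^+$, $H_k^{(X,\vec\varphi)}(\vec u,\vec v)$ is the image of the homomorphism $i_*:H_k(X\langle\vec\varphi\preceq\vec u\rangle)\to H_k(X\langle\vec\varphi\preceq\vec v\rangle)$ induced by inclusion. The function $H_k^{(X,\vec\varphi)}$, taking each $(\vec u,\vec v)\in\Delta^+$ to the Abelian group $H_k^{(X,\vec\varphi)}(\vec u,\vec v)$ (considered up to isomorphism), is called the multidimensional $k$th persistent homology group of $(X,\vec\varphi)$. Definition of $d_T$: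 given $(X,\vec\varphi)$ and $(Y,\vec\psi)$, let $E$ be the set of all real $\epsilon\ge 0$ such that, with $\vec\epsilon=(\epsilon,\dots,\epsilon)\in\mathbb{R}^n$, for every $(\vec u,\vec v)\in\Delta^+$: (1) there is a surjective homomorphism from a subgroup of $H_k^{(X,\vec\varphi)}(\vec u,\vec v)$ onto $H_k^{(Y,\vec\psi)}(\vec u-\vec\epsilon,\vec v+\vec\epsilon)$; and (2) there is a surjective homomorphism from a subgroup of $H_k^{(Y,\vec\psi)}(\vec u,\vec v)$ onto $H_k^{(X,\vec\varphi)}(\vec u-\vec\epsilon,\vec v+\vec\epsilon)$. Then $d_T\left(H_k^{(X,\vec\varphi)},H_k^{(Y,\vec\psi)}\right)=\inf E$ if $E\neq\emptyset$, and $=\infty$ otherwise. A pseudo-distance is a function verifying all the properties of a distance (non-negativity, vanishing on pairs of equal elements, symmetry, triangle inequality) except possibly that elements with vanishing distance must coincide. "Extended" means that the value $\infty$ is allowed. *)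

theory Defs
  imports "HOL-Homology.Homology" "HOL-Library.Extended_Real"
begin

section \<open>Singular homology with coefficients in an Abelian group\<close>

text \<open>
  HOL-Homology provides singular homology with integer coefficients only. Its singular simplices,
  faces and simplex maps are kept here; the coefficients of a chain are taken in an arbitrary type
  of class \<^class>\<open>ab_group_add\<close>. As in the library, the degree is an integer; there are no nonzero
  chains in negative degrees.
\<close>

type_synonym ('a, 'g) coeff_chain = "((nat \<Rightarrow> real) \<Rightarrow> 'a) \<Rightarrow>\<^sub>0 'g"

definition coeff_chain_group :: "int \<Rightarrow> 'a topology \<Rightarrow> ('a, 'g::ab_group_add) coeff_chain monoid"
  where "coeff_chain_group k X =
    \<lparr>carrier = {c. Poly_Mapping.keys c \<subseteq> {\<sigma>. 0 \<le> k \<and> singular_simplex (nat k) X \<sigma>}},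
     monoid.mult = (+), one = 0\<rparr>"

definition coeff_boundary :: "int \<Rightarrow> ('a, 'g::ab_group_add) coeff_chain \<Rightarrow> ('a, 'g) coeff_chain"
  where "coeff_boundary k c =
    (if k \<le> 0 then 0
     else \<Sum>\<sigma>\<in>Poly_Mapping.keys c. \<Sum>i\<le>nat k.
       Poly_Mapping.single (singular_face (nat k) i \<sigma>)
         (if even i then Poly_Mapping.lookup c \<sigma> else - Poly_Mapping.lookup c \<sigma>))"

definition coeff_cycles :: "int \<Rightarrow> 'a topology \<Rightarrow> ('a, 'g::ab_group_add) coeff_chain set"
  where "coeff_cycles k X = {c \<in> carrier (coeff_chain_group k X). coeff_boundary k c = 0}"

definition coeff_boundaries :: "int \<Rightarrow> 'a topology \<Rightarrow> ('a, 'g::ab_group_add) coeff_chain set"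
  where "coeff_boundaries k X = coeff_boundary (k + 1) ` carrier (coeff_chain_group (k + 1) X)"

definition coeff_homology_group ::
    "int \<Rightarrow> 'a topology \<Rightarrow> ('a, 'g::ab_group_add) coeff_chain set monoid"
  where "coeff_homology_group k X =
    (coeff_chain_group k X)\<lparr>carrier := coeff_cycles k X\<rparr> Mod coeff_boundaries k X"

definition coeff_chain_map ::
    "int \<Rightarrow> ('a \<Rightarrow> 'b) \<Rightarrow> ('a, 'g::ab_group_add) coeff_chain \<Rightarrow> ('b, 'g) coeff_chain"
  where "coeff_chain_map k f c =
    (\<Sum>\<sigma>\<in>Poly_Mapping.keys c.
       Poly_Mapping.single (simplex_map (nat k) f \<sigma>) (Poly_Mapping.lookup c \<sigma>))"

text \<open>
  The homomorphism induced by a continuous map \<open>f\<close> into \<open>Y\<close>. A homology class \<open>A\<close> is a coset;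
  adding all boundaries of \<open>Y\<close> to the image of \<open>A\<close> under the chain map gives the coset of the image
  of any representative of \<open>A\<close>.
\<close>

definition coeff_hom_induced ::
    "int \<Rightarrow> 'b topology \<Rightarrow> ('a \<Rightarrow> 'b) \<Rightarrow>
     ('a, 'g::ab_group_add) coeff_chain set \<Rightarrow> ('b, 'g) coeff_chain set"
  where "coeff_hom_induced k Y f A =
    coeff_boundaries k Y <#>\<^bsub>coeff_chain_group k Y\<^esub> (coeff_chain_map k f ` A)"

text \<open>For integer coefficients these notions are those of the library.\<close>

lemma coeff_boundary_int:
  fixes c :: "'a chain"
  shows "coeff_boundary (int p) c = chain_boundary p c"
proof -
  have "frag_cmul a (frag_cmul ((-1) ^ i) (frag_of s)) = Poly_Mapping.single s (if even i then a else - a)"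
    for s :: "(nat \<Rightarrow> real) \<Rightarrow> 'a" and i :: nat and a :: int
    by (rule poly_mapping_eqI) (auto simp: lookup_single when_def)
  then show ?thesis
    by (simp only: coeff_boundary_def chain_boundary_def frag_extend_def frag_cmul_sum nat_int
        of_nat_le_0_iff o_def)
qed

lemma coeff_chain_map_int:
  fixes f :: "'a \<Rightarrow> 'b"
  shows "coeff_chain_map (int p) f c = chain_map p f c"
proof -
  have "frag_cmul a (frag_of s) = Poly_Mapping.single s a"
    for s :: "(nat \<Rightarrow> real) \<Rightarrow> 'b" and a :: int
    by (rule poly_mapping_eqI) (auto simp: lookup_single when_def)
  then show ?thesis
    by (simp only: coeff_chain_map_def chain_map_def frag_extend_def nat_int o_def)
qed

lemma coeff_boundaries_int:
  fixes X :: "'a topology"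
  shows "coeff_boundaries (int p) X = singular_relboundary_set p X {}"
proof -
  have "coeff_boundary (int p + 1) c = chain_boundary (Suc p) c" for c :: "'a chain"
    using coeff_boundary_int[of "Suc p" c] by (simp add: add.commute)
  moreover have "carrier (coeff_chain_group (int p + 1) X) = singular_chain_set (Suc p) X"
    by (auto simp: coeff_chain_group_def singular_chain_def nat_add_distrib)
  ultimately show ?thesis
    by (auto simp: coeff_boundaries_def singular_boundary)
qed

lemma coeff_homology_group_int:
  fixes X :: "'a topology"
  shows "coeff_homology_group (int p) X = homology_group (int p) X"
proof -
  have chain: "carrier (coeff_chain_group (int q) X) = singular_chain_set q X" for q
    by (auto simp: coeff_chain_group_def singular_chain_def)
  have cycles: "coeff_cycles (int p) X = singular_relcycle_set p X {}"
    unfolding coeff_cycles_def chain by (intro Set.set_eqI) (simp add: coeff_boundary_int singular_cycle)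
  have "(coeff_chain_group (int p) X)\<lparr>carrier := coeff_cycles (int p) X\<rparr> = relcycle_group p X {}"
  proof (rule monoid.equality)
    show "carrier ((coeff_chain_group (int p) X)\<lparr>carrier := coeff_cycles (int p) X\<rparr>)
        = carrier (relcycle_group p X {})"
      by (simp add: cycles)
  qed (simp_all only: coeff_chain_group_def relcycle_group_def subgroup_generated_def
        chain_group_def free_Abelian_group_def monoid.simps partial_object.simps)
  then show ?thesis
    by (simp add: coeff_homology_group_def relative_homology_group_def coeff_boundaries_int)
qed

lemma coeff_hom_induced_int:
  fixes f :: "'a \<Rightarrow> 'b"
  assumes f: "continuous_map X Y f" and A: "A \<in> carrier (homology_group (int p) X)"
  shows "coeff_hom_induced (int p) Y f A = hom_induced (int p) X {} Y {} f A"
proof -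
  obtain c where c: "singular_relcycle p X {} c" and Ac: "A = homologous_rel_set p X {} c"
    using A by (auto simp: carrier_relative_homology_group)
  have "hom_induced (int p) X {} Y {} f A = homologous_rel_set p Y {} (chain_map p f c)"
    unfolding Ac using f c by (intro hom_induced_chain_map) auto
  moreover have "coeff_hom_induced (int p) Y f A = homologous_rel_set p Y {} (chain_map p f c)"
  proof (intro Set.set_eqI iffI)
    fix x assume "x \<in> coeff_hom_induced (int p) Y f A"
    then obtain b c' where b: "singular_relboundary p Y {} b"
      and c': "homologous_rel p X {} c c'" and x: "x = b + chain_map p f c'"
      by (auto simp: coeff_hom_induced_def set_mult_def coeff_boundaries_int coeff_chain_group_def
          coeff_chain_map_int Ac)
    have "homologous_rel p Y {} (chain_map p f c) (chain_map p f c')"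
      using singular_relboundary_chain_map[of p X "{}" "c - c'" Y f "{}"] c' f
      by (simp add: homologous_rel_def chain_map_diff)
    moreover have "homologous_rel p Y {} (chain_map p f c') x"
      using b by (simp add: x homologous_rel_def singular_relboundary_minus)
    ultimately show "x \<in> homologous_rel_set p Y {} (chain_map p f c)"
      using homologous_rel_trans by blast
  next
    fix x assume "x \<in> homologous_rel_set p Y {} (chain_map p f c)"
    then have "homologous_rel p Y {} x (chain_map p f c)"
      using homologous_rel_sym by blast
    then have "x - chain_map p f c \<in> coeff_boundaries (int p) Y"
      by (simp add: homologous_rel_def coeff_boundaries_int)
    moreover have "chain_map p f c \<in> coeff_chain_map (int p) f ` A"
      using imageI[of c A "chain_map p f"] by (simp add: Ac coeff_chain_map_int)
    moreover have "x = (x - chain_map p f c) + chain_map p f c"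
      by simp
    ultimately show "x \<in> coeff_hom_induced (int p) Y f A"
      unfolding coeff_hom_induced_def set_mult_def coeff_chain_group_def monoid.simps by blast
  qed
  ultimately show ?thesis
    by simp
qed


section \<open>Multidimensional persistent homology groups\<close>

text \<open>
  The strict order of type \<^typ>\<open>real ^ 'n\<close> is not the relation needed here: it means
  coordinatewise \<open>\<le>\<close> with strict inequality in at least one coordinate.
\<close>

definition Delta_plus :: "((real ^ 'n) \<times> (real ^ 'n)) set"
  where "Delta_plus = {(u, v). \<forall>i. u $ i < v $ i}"

definition sublevel_space :: "'a topology \<Rightarrow> ('a \<Rightarrow> real ^ 'n) \<Rightarrow> real ^ 'n \<Rightarrow> 'a topology"
  where "sublevel_space X \<phi> u = subtopology X {x \<in> topspace X. \<forall>i. \<phi> x $ i \<le> u $ i}"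

definition persistent_homology_group ::
    "'g::ab_group_add itself \<Rightarrow> int \<Rightarrow> 'a topology \<Rightarrow> ('a \<Rightarrow> real ^ 'n) \<Rightarrow>
     real ^ 'n \<Rightarrow> real ^ 'n \<Rightarrow> ('a, 'g) coeff_chain set monoid"
  where "persistent_homology_group G k X \<phi> u v =
    (coeff_homology_group k (sublevel_space X \<phi> v))
      \<lparr>carrier := coeff_hom_induced k (sublevel_space X \<phi> v) id
                   ` carrier (coeff_homology_group k (sublevel_space X \<phi> u))\<rparr>"

text \<open>
  The persistent homology groups are functions on \<open>\<Delta>\<^sup>+\<close> whose values matter up to isomorphism only;
  this is the resulting notion of equality between them.
\<close>

definition same_persistent_homology ::
    "(real ^ 'n \<Rightarrow> real ^ 'n \<Rightarrow> 'c monoid) \<Rightarrow> (real ^ 'n \<Rightarrow> real ^ 'n \<Rightarrow> 'd monoid) \<Rightarrow> bool"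
  where "same_persistent_homology F F' \<longleftrightarrow> (\<forall>(u, v) \<in> Delta_plus. F u v \<cong> F' u v)"


section \<open>The extended pseudo-distance\<close>

definition subgroup_surjects_onto :: "'c monoid \<Rightarrow> 'd monoid \<Rightarrow> bool"
  where "subgroup_surjects_onto A B \<longleftrightarrow> (\<exists>S h. subgroup S A \<and> h \<in> epi (A\<lparr>carrier := S\<rparr>) B)"

definition dT_admissible ::
    "(real ^ 'n \<Rightarrow> real ^ 'n \<Rightarrow> 'c monoid) \<Rightarrow> (real ^ 'n \<Rightarrow> real ^ 'n \<Rightarrow> 'd monoid) \<Rightarrow> real set"
  where "dT_admissible F F' =
    {\<epsilon>. 0 \<le> \<epsilon> \<and> (\<forall>(u, v) \<in> Delta_plus.
       subgroup_surjects_onto (F u v) (F' (u - vec \<epsilon>) (v + vec \<epsilon>)) \<and>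
       subgroup_surjects_onto (F' u v) (F (u - vec \<epsilon>) (v + vec \<epsilon>)))}"

definition dT ::
    "(real ^ 'n \<Rightarrow> real ^ 'n \<Rightarrow> 'c monoid) \<Rightarrow> (real ^ 'n \<Rightarrow> real ^ 'n \<Rightarrow> 'd monoid) \<Rightarrow> ereal"
  where "dT F F' = (if dT_admissible F F' \<noteq> {} then ereal (Inf (dT_admissible F F')) else \<infinity>)"

end

(* An epimorphism of a subgroup of A onto B and one of a subgroup T of B onto C compose on the preimage
   of T, so admissible values add up; taking infima gives the triangle inequality. Invariance under
   isomorphism follows from it, isomorphic families being at distance 0. *)

theory Submission
  imports Defs
begin

section \<open>Surjections from subgroups: isomorphisms and composition\<close>

lemma subgroup_surjects_onto_iso:
  assumes "group A" and "A \<cong> B"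
  shows "subgroup_surjects_onto A B"
proof -
  obtain h where "h \<in> iso A B"
    using assms(2) by (auto simp: is_iso_def)
  then have "h \<in> epi (A\<lparr>carrier := carrier A\<rparr>) B"
    by (simp add: iso_iff_mon_epi)
  moreover have "subgroup (carrier A) A"
    using assms(1) by (rule group.subgroup_self)
  ultimately show ?thesis
    unfolding subgroup_surjects_onto_def by blast
qed

lemma subgroup_surjects_onto_trans:
  assumes A: "group A" and B: "group B"
    and "subgroup_surjects_onto A B" and "subgroup_surjects_onto B C"
  shows "subgroup_surjects_onto A C"
proof -
  obtain S h where S: "subgroup S A" and h: "h \<in> epi (A\<lparr>carrier := S\<rparr>) B"
    using assms(3) by (auto simp: subgroup_surjects_onto_def)
  obtain T g where T: "subgroup T B" and g: "g \<in> epi (B\<lparr>carrier := T\<rparr>) C"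
    using assms(4) by (auto simp: subgroup_surjects_onto_def)
  define S' where "S' = {s \<in> S. h s \<in> T}"
  have grp: "group (A\<lparr>carrier := S\<rparr>)"
    using S A by (rule subgroup.subgroup_is_group)
  \<comment> \<open>Membership in \<open>hom\<close> only says that products are preserved. With
    groups on both sides, \<open>h\<close> also preserves the unit and inverses, which makes the
    preimage \<open>S'\<close> a subgroup.\<close>
  have hom: "group_hom (A\<lparr>carrier := S\<rparr>) B h"
    using grp B h by (simp add: group_hom_def group_hom_axioms_def epi_def)
  have "subgroup S' (A\<lparr>carrier := S\<rparr>)"
  proof (rule group.subgroupI [OF grp])
    have "\<one>\<^bsub>A\<lparr>carrier := S\<rparr>\<^esub> \<in> S'"
      using subgroup.one_closed [OF S] subgroup.one_closed [OF T] group_hom.hom_one [OF hom]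
      by (simp add: S'_def)
    then show "S' \<noteq> {}"
      by blast
  next
    fix s assume "s \<in> S'"
    then show "inv\<^bsub>A\<lparr>carrier := S\<rparr>\<^esub> s \<in> S'"
      using group.inv_closed [OF grp] group_hom.hom_inv [OF hom] subgroup.m_inv_closed [OF T]
      by (simp add: S'_def)
  next
    fix s t assume "s \<in> S'" "t \<in> S'"
    then show "s \<otimes>\<^bsub>A\<lparr>carrier := S\<rparr>\<^esub> t \<in> S'"
      using subgroup.m_closed [OF S] group_hom.hom_mult [OF hom] subgroup.m_closed [OF T]
      by (simp add: S'_def)
  qed (auto simp: S'_def)
  then have "subgroup S' A"
    using group.incl_subgroup [OF A S] by blast
  moreover have "g \<circ> h \<in> hom (A\<lparr>carrier := S'\<rparr>) C"
    using h g by (auto simp: epi_def hom_def S'_def Pi_iff)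
  moreover have "(g \<circ> h) ` S' = carrier C"
  proof -
    \<comment> \<open>Since \<open>h\<close> maps \<open>S\<close> onto all of \<open>B\<close>,
      each element of \<open>T\<close> has a preimage in \<open>S\<close>, which then lies in
      \<open>S'\<close>. So \<open>g\<close> is applied to its whole domain and stays onto.\<close>
    have "h ` S' = T"
      using h subgroup.subset [OF T] by (auto simp: epi_def S'_def)
    then show ?thesis
      unfolding image_comp [symmetric] using g by (simp add: epi_def)
  qed
  ultimately show ?thesis
    unfolding subgroup_surjects_onto_def by (intro exI [of _ S'] exI [of _ "g \<circ> h"]) (simp add: epi_def)
qed

section \<open>Admissible values and the pseudo-distance for arbitrary families of groups\<close>

lemma dT_admissible_sym: "dT_admissible F F' = dT_admissible F' F"
  unfolding dT_admissible_def by blast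

text \<open>Only one direction is recorded; the other is this one for the swapped pair, by
  \<open>dT_admissible_sym\<close>.\<close>

lemma dT_admissibleD:
  "\<epsilon> \<in> dT_admissible F F' \<Longrightarrow> (u, v) \<in> Delta_plus
    \<Longrightarrow> subgroup_surjects_onto (F u v) (F' (u - vec \<epsilon>) (v + vec \<epsilon>))"
  unfolding dT_admissible_def by blast

lemma dT_sym: "dT F F' = dT F' F"
  by (simp add: dT_def dT_admissible_sym [of F F'])

lemma bdd_below_dT_admissible: "bdd_below (dT_admissible F F')"
  by (rule bdd_belowI [of _ 0]) (simp add: dT_admissible_def)

lemma dT_nonneg: "0 \<le> dT F F'"
  by (auto simp: dT_def dT_admissible_def intro: cInf_greatest)

lemma dT_le: "\<epsilon> \<in> dT_admissible F F' \<Longrightarrow> dT F F' \<le> ereal \<epsilon>"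
  by (auto simp: dT_def intro: cInf_lower bdd_below_dT_admissible)

text \<open>At \<epsilon> = 0 the shifts vanish, and an isomorphism and its inverse give the two
  surjections, each defined on the whole group. So 0 is admissible and bounds the infimum from
  above.\<close>

lemma dT_same_persistent_homology:
  assumes "\<And>u v. (u, v) \<in> Delta_plus \<Longrightarrow> group (F u v)"
    and "\<And>u v. (u, v) \<in> Delta_plus \<Longrightarrow> group (F' u v)"
    and "same_persistent_homology F F'"
  shows "dT F F' = 0"
proof (rule antisym)
  have "vec 0 = (0 :: real ^ 'n)"
    by (simp add: vec_eq_iff)
  then have "0 \<in> dT_admissible F F'"
    using assms
    by (fastforce simp: dT_admissible_def same_persistent_homology_def
        intro: subgroup_surjects_onto_iso group.iso_sym)
  then show "dT F F' \<le> 0"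
    using dT_le by (fastforce simp: zero_ereal_def)
qed (rule dT_nonneg)

lemma dT_admissible_add:
  fixes F :: "real ^ 'n \<Rightarrow> real ^ 'n \<Rightarrow> 'c monoid"
  assumes F: "\<And>u v. (u, v) \<in> Delta_plus \<Longrightarrow> group (F u v)"
    and F': "\<And>u v. (u, v) \<in> Delta_plus \<Longrightarrow> group (F' u v)"
    and F'': "\<And>u v. (u, v) \<in> Delta_plus \<Longrightarrow> group (F'' u v)"
    and a: "a \<in> dT_admissible F F'" and b: "b \<in> dT_admissible F' F''"
  shows "a + b \<in> dT_admissible F F''"
proof -
  have nonneg: "0 \<le> a" "0 \<le> b"
    using a b by (auto simp: dT_admissible_def)
  \<comment> \<open>A nonnegative shift widens the gap between \<open>u\<close> and
    \<open>v\<close>, so the second admissibility condition may be used at the shifted pair.\<close>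
  have Delta: "(u - vec e, v + vec e) \<in> Delta_plus" if "(u, v) \<in> Delta_plus" "0 \<le> e" for u v :: "real ^ 'n" and e
  proof -
    have "u $ i - e < v $ i + e" for i
    proof -
      have "u $ i < v $ i"
        using that by (simp add: Delta_plus_def)
      then show ?thesis
        using that by linarith
    qed
    then show ?thesis
      by (simp add: Delta_plus_def)
  qed
  have "subgroup_surjects_onto (F u v) (F'' (u - vec (a + b)) (v + vec (a + b)))
      \<and> subgroup_surjects_onto (F'' u v) (F (u - vec (a + b)) (v + vec (a + b)))"
    if uv: "(u, v) \<in> Delta_plus" for u v
  proof
    have eqs: "u - vec a - vec b = u - vec (a + b)" "v + vec a + vec b = v + vec (a + b)"
      "u - vec b - vec a = u - vec (a + b)" "v + vec b + vec a = v + vec (a + b)"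
      by (simp_all add: vec_eq_iff)
    have ua: "(u - vec a, v + vec a) \<in> Delta_plus" and ub: "(u - vec b, v + vec b) \<in> Delta_plus"
      using Delta uv nonneg by blast+
    show "subgroup_surjects_onto (F u v) (F'' (u - vec (a + b)) (v + vec (a + b)))"
      using subgroup_surjects_onto_trans [OF F [OF uv] F' [OF ua] dT_admissibleD [OF a uv]
          dT_admissibleD [OF b ua]] by (simp only: eqs)
    \<comment> \<open>Coming back from \<open>F''\<close>, the shift by \<open>b\<close> is made
      first, so the intermediate group is that of \<open>F'\<close> at the pair shifted by
      \<open>b\<close> instead of \<open>a\<close>.\<close>
    show "subgroup_surjects_onto (F'' u v) (F (u - vec (a + b)) (v + vec (a + b)))"
      using subgroup_surjects_onto_trans [OF F'' [OF uv] F' [OF ub]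
          dT_admissibleD [OF b [unfolded dT_admissible_sym [of F']] uv]
          dT_admissibleD [OF a [unfolded dT_admissible_sym [of F]] ub]] by (simp only: eqs)
  qed
  then show ?thesis
    using nonneg by (auto simp: dT_admissible_def)
qed

lemma dT_triangle:
  fixes F :: "real ^ 'n \<Rightarrow> real ^ 'n \<Rightarrow> 'c monoid"
  assumes "\<And>u v. (u, v) \<in> Delta_plus \<Longrightarrow> group (F u v)"
    and "\<And>u v. (u, v) \<in> Delta_plus \<Longrightarrow> group (F' u v)"
    and "\<And>u v. (u, v) \<in> Delta_plus \<Longrightarrow> group (F'' u v)"
  shows "dT F F'' \<le> dT F F' + dT F' F''"
\<comment> \<open>An empty set makes the right-hand side infinite. Otherwise both distances there
  are real infima and the estimate takes place in the reals.\<close>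
proof (cases "dT_admissible F F' = {} \<or> dT_admissible F' F'' = {}")
  case True
  then show ?thesis
    using dT_nonneg [of F F'] dT_nonneg [of F' F''] by (auto simp: dT_def)
next
  case False
  have add: "a + b \<in> dT_admissible F F''"
    if "a \<in> dT_admissible F F'" "b \<in> dT_admissible F' F''" for a b
    using dT_admissible_add [of F F' F''] assms that by blast
  have lower: "Inf (dT_admissible F F'') \<le> a + b"
    if "a \<in> dT_admissible F F'" "b \<in> dT_admissible F' F''" for a b
    using add [OF that] by (rule cInf_lower) (rule bdd_below_dT_admissible)
  \<comment> \<open>The infima are taken one variable at a time: over \<open>b\<close> with
    \<open>a\<close> fixed, then over \<open>a\<close>.\<close>
  have "Inf (dT_admissible F F'') - a \<le> Inf (dT_admissible F' F'')"
    if "a \<in> dT_admissible F F'" for a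
    using False lower [OF that] by (intro cInf_greatest) (auto simp: algebra_simps)
  then have "Inf (dT_admissible F F'') - Inf (dT_admissible F' F'') \<le> Inf (dT_admissible F F')"
    using False by (intro cInf_greatest) (auto simp: algebra_simps)
  moreover have "dT_admissible F F'' \<noteq> {}"
    using False add by blast
  ultimately show ?thesis
    using False by (simp add: dT_def)
qed

lemma dT_eq_if_same_persistent_homology:
  fixes F :: "real ^ 'n \<Rightarrow> real ^ 'n \<Rightarrow> 'c monoid"
  assumes F: "\<And>u v. (u, v) \<in> Delta_plus \<Longrightarrow> group (F u v)"
    and F': "\<And>u v. (u, v) \<in> Delta_plus \<Longrightarrow> group (F' u v)"
    and F'': "\<And>u v. (u, v) \<in> Delta_plus \<Longrightarrow> group (F'' u v)"
    and same: "same_persistent_homology F F'"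
  shows "dT F F'' = dT F' F''"
proof (rule antisym)
  have "dT F F' = 0" "dT F' F = 0"
    using dT_same_persistent_homology [OF F F' same] by (simp_all add: dT_sym [of F' F])
  then show "dT F F'' \<le> dT F' F''" "dT F' F'' \<le> dT F F''"
    using dT_triangle [of F F' F''] dT_triangle [of F' F F''] F F' F'' by simp_all
qed

section \<open>Chains, cycles and boundaries with coefficients\<close>

lemma coeff_boundary_superset:
  assumes "finite K" and "Poly_Mapping.keys c \<subseteq> K" and "0 < k"
  shows "coeff_boundary k c = (\<Sum>\<sigma>\<in>K. \<Sum>i\<le>nat k.
       Poly_Mapping.single (singular_face (nat k) i \<sigma>)
         (if even i then Poly_Mapping.lookup c \<sigma> else - Poly_Mapping.lookup c \<sigma>))"
proof -
  \<comment> \<open>A simplex outside the support has coefficient 0 and contributes nothing, so the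
    index set may be enlarged.\<close>
  have "(\<Sum>i\<le>nat k. Poly_Mapping.single (singular_face (nat k) i \<sigma>)
      (if even i then Poly_Mapping.lookup c \<sigma> else - Poly_Mapping.lookup c \<sigma>)) = 0"
    if "\<sigma> \<in> K - Poly_Mapping.keys c" for \<sigma>
    using that by (auto simp: in_keys_iff intro!: sum.neutral)
  then show ?thesis
    using assms(3) unfolding coeff_boundary_def
    by (subst sum.mono_neutral_left [OF assms(1,2)]) auto
qed

lemma coeff_boundary_add: "coeff_boundary k (c + d) = coeff_boundary k c + coeff_boundary k d"
proof (cases "0 < k")
  case True
  \<comment> \<open>The two chains and their sum have different supports, and cancellation may
    shrink that of the sum. Over a common finite index set the three boundaries can be compared term
    by term.\<close>
  define K where "K = Poly_Mapping.keys c \<union> Poly_Mapping.keys d"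
  have K: "finite K" "Poly_Mapping.keys c \<subseteq> K" "Poly_Mapping.keys d \<subseteq> K" "Poly_Mapping.keys (c + d) \<subseteq> K"
    using Poly_Mapping.keys_add [of c d] by (auto simp: K_def)
  show ?thesis
    unfolding coeff_boundary_superset [OF K(1,2) True] coeff_boundary_superset [OF K(1,3) True]
      coeff_boundary_superset [OF K(1,4) True] sum.distrib [symmetric]
    by (intro sum.cong refl) (simp add: lookup_add single_diff single_add single_uminus)
qed (simp add: coeff_boundary_def)

lemma coeff_boundary_0: "coeff_boundary k 0 = 0"
  by (simp add: coeff_boundary_def)

lemma coeff_boundary_minus: "coeff_boundary k (- c) = - coeff_boundary k c"
  using coeff_boundary_add [of k "- c" c] by (simp add: eq_neg_iff_add_eq_0 coeff_boundary_0)

text \<open>\<open>simplex_map\<close> restricts its result to the standard simplex. Singular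
  simplices are extensional there, so composing with the identity returns them unchanged as
  functions.\<close>

lemma coeff_chain_map_id:
  assumes "c \<in> carrier (coeff_chain_group k X)"
  shows "coeff_chain_map k id c = c"
proof -
  have "simplex_map (nat k) id \<sigma> = \<sigma>" if "\<sigma> \<in> Poly_Mapping.keys c" for \<sigma>
    using that assms
    by (auto simp: coeff_chain_group_def simplex_map_def singular_simplex_def extensional_restrict)
  then have "coeff_chain_map k id c =
      (\<Sum>\<sigma>\<in>Poly_Mapping.keys c. Poly_Mapping.single \<sigma> (Poly_Mapping.lookup c \<sigma>))"
    by (simp add: coeff_chain_map_def)
  also have "\<dots> = c"
    by (rule poly_mapping_eqI) (simp add: lookup_sum lookup_single when_def in_keys_iff)
  finally show ?thesis .
qed

text \<open>One ambient group for all spaces and degrees: chains, cycles and boundaries of every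
  sublevel set become subgroups of it, and cosets for different sublevel sets can be compared
  directly.\<close>

abbreviation additive_group :: "'x::ab_group_add monoid"
  where "additive_group \<equiv> \<lparr>carrier = UNIV, monoid.mult = (+), one = 0\<rparr>"

lemma comm_group_additive_group: "comm_group (additive_group :: 'x::ab_group_add monoid)"
proof (rule comm_groupI)
  fix x :: 'x
  show "\<exists>y\<in>carrier additive_group. y \<otimes>\<^bsub>additive_group\<^esub> x = \<one>\<^bsub>additive_group\<^esub>"
    by (rule bexI [of _ "- x"]) simp_all
qed (simp_all add: algebra_simps)

lemma subgroup_additive_groupI:
  fixes S :: "'x::ab_group_add set"
  assumes "0 \<in> S" "\<And>x y. x \<in> S \<Longrightarrow> y \<in> S \<Longrightarrow> x + y \<in> S" "\<And>x. x \<in> S \<Longrightarrow> - x \<in> S"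
  shows "subgroup S additive_group"
proof -
  interpret comm_group "additive_group :: 'x monoid"
    by (rule comm_group_additive_group)
  have "inv\<^bsub>additive_group\<^esub> x = - x" for x :: 'x
    by (rule inv_equality) auto
  then show ?thesis
    using assms by (intro subgroupI) auto
qed

lemma coeff_chain_group_closed:
  shows "0 \<in> carrier (coeff_chain_group k X)"
    and "c \<in> carrier (coeff_chain_group k X) \<Longrightarrow> d \<in> carrier (coeff_chain_group k X)
      \<Longrightarrow> c + d \<in> carrier (coeff_chain_group k X)"
    and "c \<in> carrier (coeff_chain_group k X) \<Longrightarrow> - c \<in> carrier (coeff_chain_group k X)"
  using Poly_Mapping.keys_add [of c d] by (auto simp: coeff_chain_group_def)

lemma coeff_boundary_closed:
  assumes "c \<in> carrier (coeff_chain_group (k + 1) X)"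
  shows "coeff_boundary (k + 1) c \<in> carrier (coeff_chain_group k X)"
\<comment> \<open>For negative \<open>k\<close> the degree \<open>k + 1\<close> is at most 0, where
  the boundary is 0 by definition.\<close>
proof (cases "0 \<le> k")
  case True
  have sum_closed: "sum f A \<in> carrier (coeff_chain_group k X)"
    if "\<And>i. i \<in> A \<Longrightarrow> f i \<in> carrier (coeff_chain_group k X)" for f and A :: "'i set"
    using that by (induction A rule: infinite_finite_induct) (auto intro: coeff_chain_group_closed)
  have "singular_simplex (nat k) X (singular_face (nat (k + 1)) i \<sigma>)"
    if "\<sigma> \<in> Poly_Mapping.keys c" "i \<le> nat (k + 1)" for \<sigma> i
    using that assms True singular_simplex_singular_face [of "nat (k + 1)" X \<sigma> i]
    by (auto simp: coeff_chain_group_def nat_add_distrib)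
  then have "Poly_Mapping.single (singular_face (nat (k + 1)) i \<sigma>) g \<in> carrier (coeff_chain_group k X)"
    if "\<sigma> \<in> Poly_Mapping.keys c" "i \<le> nat (k + 1)" for \<sigma> i and g :: 'b
    using that True by (simp add: coeff_chain_group_def)
  then show ?thesis
    unfolding coeff_boundary_def by (auto intro!: sum_closed coeff_chain_group_closed)
qed (simp add: coeff_boundary_def coeff_chain_group_closed)

lemma subgroup_coeff_chain_group: "subgroup (carrier (coeff_chain_group k X)) additive_group"
  by (rule subgroup_additive_groupI) (rule coeff_chain_group_closed; assumption)+

lemma group_hom_coeff_boundary: "group_hom additive_group additive_group (coeff_boundary k)"
  by (intro group_hom.intro group_hom_axioms.intro comm_group.axioms comm_group_additive_group)
    (simp add: hom_def coeff_boundary_add)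

lemma subgroup_coeff_boundaries: "subgroup (coeff_boundaries k X) additive_group"
  unfolding coeff_boundaries_def
  by (rule group_hom.subgroup_img_is_subgroup [OF group_hom_coeff_boundary subgroup_coeff_chain_group])

lemma subgroup_coeff_cycles: "subgroup (coeff_cycles k X) additive_group"
proof (rule subgroup_additive_groupI)
  show "0 \<in> coeff_cycles k X"
    by (simp add: coeff_cycles_def coeff_chain_group_closed coeff_boundary_0)
  show "x + y \<in> coeff_cycles k X" if "x \<in> coeff_cycles k X" "y \<in> coeff_cycles k X" for x y :: "('a, 'b) coeff_chain"
    using that by (simp add: coeff_cycles_def coeff_chain_group_closed coeff_boundary_add)
  show "- x \<in> coeff_cycles k X" if "x \<in> coeff_cycles k X" for x :: "('a, 'b) coeff_chain"
    using that by (simp add: coeff_cycles_def coeff_chain_group_closed coeff_boundary_minus)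
qed

section \<open>Persistent homology groups as subgroups of quotients\<close>

lemma coeff_boundaries_sublevel_mono:
  assumes "(u, v) \<in> Delta_plus"
  shows "coeff_boundaries k (sublevel_space X \<phi> u) \<subseteq> coeff_boundaries k (sublevel_space X \<phi> v)"
proof -
  have "{x \<in> topspace X. \<forall>i. \<phi> x $ i \<le> u $ i} \<subseteq> {x \<in> topspace X. \<forall>i. \<phi> x $ i \<le> v $ i}"
    using assms by (auto simp: Delta_plus_def) (meson less_imp_le order_trans)
  \<comment> \<open>Simplices of the smaller sublevel set are simplices of the larger one, and the
    boundary formula does not depend on the space.\<close>
  then have "carrier (coeff_chain_group (k + 1) (sublevel_space X \<phi> u))
      \<subseteq> carrier (coeff_chain_group (k + 1) (sublevel_space X \<phi> v))"
    unfolding coeff_chain_group_def sublevel_space_def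
    by (auto simp: singular_simplex_subtopology)
  then show ?thesis
    unfolding coeff_boundaries_def by (rule image_mono)
qed

text \<open>
  The image of \<open>H\<^sub>k\<close> of the lower sublevel set consists of the cosets of the boundaries of the upper
  one that are represented by cycles of the lower one: the image of a subgroup in a quotient of the
  additive group of all chains.
\<close>

lemma group_persistent_homology_group:
  fixes \<phi> :: "'a \<Rightarrow> real ^ 'n"
  assumes uv: "(u, v) \<in> Delta_plus"
  shows "group (persistent_homology_group TYPE('g::ab_group_add) k X \<phi> u v)"
proof -
  let ?M = "additive_group :: ('a, 'g) coeff_chain monoid"
  define Bu Bv Z :: "('a, 'g) coeff_chain set"
    where "Bu = coeff_boundaries k (sublevel_space X \<phi> u)"
      and "Bv = coeff_boundaries k (sublevel_space X \<phi> v)"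
      and "Z = coeff_cycles k (sublevel_space X \<phi> u)"
  interpret M: comm_group ?M
    by (rule comm_group_additive_group)
  have Bv: "subgroup Bv ?M" and Bu: "subgroup Bu ?M" and Z: "subgroup Z ?M"
    by (simp_all add: Bu_def Bv_def Z_def subgroup_coeff_boundaries subgroup_coeff_cycles)
  have normal: "Bv \<lhd> ?M"
    using Bv by (rule M.subgroup_imp_normal)
  have "group_hom ?M (?M Mod Bv) ((#>\<^bsub>?M\<^esub>) Bv)"
    using M.group_axioms normal.factorgroup_is_group [OF normal] normal.r_coset_hom_Mod [OF normal]
    by (simp add: group_hom_def group_hom_axioms_def)
  then have "subgroup ((#>\<^bsub>?M\<^esub>) Bv ` Z) (?M Mod Bv)"
    using Z by (rule group_hom.subgroup_img_is_subgroup)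
  then have "group ((?M Mod Bv)\<lparr>carrier := (#>\<^bsub>?M\<^esub>) Bv ` Z\<rparr>)"
    using normal.factorgroup_is_group [OF normal] by (rule subgroup.subgroup_is_group)
  \<comment> \<open>The two records are literally equal, since all the groups involved share the
    operation \<open>(+)\<close> and the unit 0. No isomorphism has to be transported.\<close>
  moreover have "persistent_homology_group TYPE('g) k X \<phi> u v
      = (?M Mod Bv)\<lparr>carrier := (#>\<^bsub>?M\<^esub>) Bv ` Z\<rparr>"
  proof -
    have induced: "coeff_hom_induced k (sublevel_space X \<phi> v) id (Bu #>\<^bsub>?M\<^esub> z) = Bv #>\<^bsub>?M\<^esub> z"
      if "z \<in> Z" for z
    proof -
      \<comment> \<open>A boundary plus a cycle of the lower sublevel set is a chain there, so the
        identity fixes every element of the coset.\<close>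
      have "coeff_chain_map k id x = x" if "x \<in> Bu #>\<^bsub>?M\<^esub> z" for x
      proof (rule coeff_chain_map_id)
        show "x \<in> carrier (coeff_chain_group k (sublevel_space X \<phi> u))"
          using that \<open>z \<in> Z\<close>
          by (auto simp: r_coset_def Bu_def Z_def coeff_boundaries_def coeff_cycles_def
              intro!: coeff_chain_group_closed coeff_boundary_closed)
      qed
      then have "coeff_chain_map k id ` (Bu #>\<^bsub>?M\<^esub> z) = Bu #>\<^bsub>?M\<^esub> z"
        by simp
      then have "coeff_hom_induced k (sublevel_space X \<phi> v) id (Bu #>\<^bsub>?M\<^esub> z)
          = Bv <#>\<^bsub>?M\<^esub> (Bu #>\<^bsub>?M\<^esub> z)"
        by (simp add: coeff_hom_induced_def Bv_def set_mult_def coeff_chain_group_def)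
      also have "\<dots> = (Bv <#>\<^bsub>?M\<^esub> Bu) #>\<^bsub>?M\<^esub> z"
        by (rule M.setmult_rcos_assoc) auto
      \<comment> \<open>\<open>Bv\<close> absorbs \<open>Bu\<close>: the lower boundaries are among
        the upper ones, and 0 lies in \<open>Bu\<close>.\<close>
      also have "Bv <#>\<^bsub>?M\<^esub> Bu = Bv"
      proof (rule antisym)
        show "Bv <#>\<^bsub>?M\<^esub> Bu \<subseteq> Bv"
          using coeff_boundaries_sublevel_mono [OF uv] subgroup.m_closed [OF Bv]
          by (fastforce simp: set_mult_def Bu_def Bv_def)
        show "Bv \<subseteq> Bv <#>\<^bsub>?M\<^esub> Bu"
          using subgroup.one_closed [OF Bu] by (force simp: set_mult_def)
      qed
      finally show ?thesis .
    qed
    have "carrier (coeff_homology_group k (sublevel_space X \<phi> u)) = (#>\<^bsub>?M\<^esub>) Bu ` Z"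
      by (auto simp: coeff_homology_group_def FactGroup_def RCOSETS_def r_coset_def Bu_def Z_def
          coeff_chain_group_def)
    then have "coeff_hom_induced k (sublevel_space X \<phi> v) id
        ` carrier (coeff_homology_group k (sublevel_space X \<phi> u)) = (#>\<^bsub>?M\<^esub>) Bv ` Z"
      by (simp add: image_image induced)
    then show ?thesis
      by (simp add: persistent_homology_group_def coeff_homology_group_def FactGroup_def
          set_mult_def [abs_def] coeff_chain_group_def Bv_def)
  qed
  ultimately show ?thesis
    by simp
qed

theorem theorem2p2:
  fixes k :: int
    and X :: "'a topology" and Y :: "'b topology" and Z :: "'c topology"
    and \<phi> :: "'a \<Rightarrow> real ^ 'n" and \<psi> :: "'b \<Rightarrow> real ^ 'n" and \<rho> :: "'c \<Rightarrow> real ^ 'n"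
  assumes "continuous_map X euclidean \<phi>"
    and "continuous_map Y euclidean \<psi>"
    and "continuous_map Z euclidean \<rho>"
  shows
    "(0 \<le> dT (persistent_homology_group TYPE('g::ab_group_add) k X \<phi>)
               (persistent_homology_group TYPE('g) k Y \<psi>)) \<and>
     (dT (persistent_homology_group TYPE('g) k X \<phi>)
          (persistent_homology_group TYPE('g) k X \<phi>) = 0) \<and>
     (same_persistent_homology (persistent_homology_group TYPE('g) k X \<phi>)
                                (persistent_homology_group TYPE('g) k Y \<psi>) \<longrightarrow>
       dT (persistent_homology_group TYPE('g) k X \<phi>)
          (persistent_homology_group TYPE('g) k Y \<psi>) = 0) \<and>
     (same_persistent_homology (persistent_homology_group TYPE('g) k X \<phi>)
                                (persistent_homology_group TYPE('g) k Y \<psi>) \<longrightarrow>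
       dT (persistent_homology_group TYPE('g) k X \<phi>)
          (persistent_homology_group TYPE('g) k Z \<rho>) =
       dT (persistent_homology_group TYPE('g) k Y \<psi>)
          (persistent_homology_group TYPE('g) k Z \<rho>)) \<and>
     (dT (persistent_homology_group TYPE('g) k X \<phi>)
          (persistent_homology_group TYPE('g) k Y \<psi>) =
       dT (persistent_homology_group TYPE('g) k Y \<psi>)
          (persistent_homology_group TYPE('g) k X \<phi>)) \<and>
     (dT (persistent_homology_group TYPE('g) k X \<phi>)
          (persistent_homology_group TYPE('g) k Z \<rho>)
       \<le> dT (persistent_homology_group TYPE('g) k X \<phi>)
             (persistent_homology_group TYPE('g) k Y \<psi>)
         + dT (persistent_homology_group TYPE('g) k Y \<psi>)
             (persistent_homology_group TYPE('g) k Z \<rho>))"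
proof -
  \<comment> \<open>The facts about \<open>dT\<close> hold for families of groups over
    \<open>Delta_plus\<close>; this makes them applicable to the three persistent homology
    groups.\<close>
  have X: "group (persistent_homology_group TYPE('g) k X \<phi> u v)"
    and Y: "group (persistent_homology_group TYPE('g) k Y \<psi> u v)"
    and Z: "group (persistent_homology_group TYPE('g) k Z \<rho> u v)"
    if "(u, v) \<in> Delta_plus" for u v :: "real ^ 'n"
    using that by (auto intro: group_persistent_homology_group)
  have "same_persistent_homology (persistent_homology_group TYPE('g) k X \<phi>)
      (persistent_homology_group TYPE('g) k X \<phi>)"
    by (simp add: same_persistent_homology_def iso_refl)
  with X Y Z show ?thesis
    by (intro conjI impI dT_nonneg dT_sym dT_triangle dT_same_persistent_homology
        dT_eq_if_same_persistent_homology)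
qed

end
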